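(* Assume Selberg's conjectures (A), (B), (C) stated in the context. Let $F\in\mathcal{S}$ and suppose $$F=F_1^{e_1}F_2^{e_2}\cdots F_k^{e_k}$$ where $F_1,\dots,F_k$ are distinct primitive elements of $\mathcal{S}$ and $e_1,\dots,e_k$ are positive integers. Then $$n_F=e_1^2+e_2^2+\cdots+e_k^2.$$
   Context: Write $\sigma=\Re s$, and for a function $\Phi$ put $\overline{\Phi}(s)=\overline{\Phi(\overline{s})}$. The Selberg class $\mathcal{S}$ is the set of Dirichlet series $F(s)=\sum_{n=1}^{\infty} a_n n^{-s}$ satisfying: (1) Analyticity: $(s-1)^mF(s)$ is (continues to) an entire function of finite order for some non-negative integer $m$. (2) Ramanujan hypothesis: $a_n\ll_\epsilon n^{\epsilon}$ for any fixed $\epsilon>0$. (3) Functional equation: there is a function $\gamma_F(s)=\epsilon Q^s\prod_{i=1}^{k}\Gamma(w_is+\mu_i)$ with $|\epsilon|=1$, $Q>0$, $w_i>0$, $\Re\mu_i\ge 0$ (the product of gamma functions may be empty) such that $\Phi(s)=\gamma_F(s)F(s)$ satisfies $\Phi(s)=\overline{\Phi}(1-s)$. (4) Euler product: $a_1=1$ and $\log F(s)=\sum_{n=1}^{\infty} b_n n^{-s}$ (for $\sigma>1$), where $b_n=0$ unless $n$ is a positive power of a prime, and $b_n\ll n^{\theta}$ for some $\theta<1/2$. $F\in\mathcal{S}$, $F\ne 1$, is primitive if $F=F_1F_2$ with $F_1,F_2\in\mathcal{S}$ implies $F_1=1$ or $F_2=1$. For a primitive Dirichlet character $\chi$, $F^\chi(s)=\sum_{n\ge1}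 a_n\chi(n)n^{-s}$. Sums over $p$ are over primes. Selberg's conjectures: (A) Regularity of distribution: for each $F\in\mathcal{S}$ with coefficients $a_n$ there is an integer $n_F$ such that $\sum_{p\le x}|a_p|^2/p=n_F\log\log x+O(1)$. (B) Orthonormality: if $F$ and $F'$ (with coefficients $a_n$ and $a'_n$) are distinct and primitive, then $n_F=1$ and $\sum_{p\le x}a_p\overline{a'_p}/p=O(1)$. (C) $GL(1)$ twists: if $\chi$ is a primitive Dirichlet character, $F$ and $F^\chi$ are in $\mathcal{S}$, and $F=\prod_{i=1}^kF_i$ with the $F_i$ primitive, then $F^\chi=\prod_{i=1}^kF_i^\chi$ and the $F_i^\chi$ are also primitive elements of $\mathcal{S}$. *)

theory Defs
  imports
    "HOL-Complex_Analysis.Complex_Analysis"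
    "HOL-Number_Theory.Number_Theory"
    "HOL-Library.Landau_Symbols"
begin

text \<open>
  A Dirichlet series \<open>\<Sum>\<^sub>n\<^sub>\<ge>\<^sub>1 a n / n^s\<close> is represented by its coefficient function \<open>a\<close>. The
  value \<open>a 0\<close> does not occur in the series; members of the Selberg class are normalised by
  \<open>a 0 = 0\<close>, so that distinct coefficient functions are distinct Dirichlet series.
\<close>

definition dseries :: "(nat \<Rightarrow> complex) \<Rightarrow> complex \<Rightarrow> complex" where
  "dseries a s = (\<Sum>n. a (Suc n) / of_nat (Suc n) powr s)"

definition one_series :: "nat \<Rightarrow> complex" where
  "one_series = (\<lambda>n. if n = 1 then 1 else 0)"

definition finite_order :: "(complex \<Rightarrow> complex) \<Rightarrow> bool" where
  "finite_order G \<longleftrightarrow>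
     (\<exists>\<rho>::real. (\<lambda>s. norm (G s)) \<in> O[at_infinity](\<lambda>s. exp (norm s powr \<rho>)))"

text \<open>
  In the next two definitions \<open>F\<close> is the continuation of the Dirichlet series to the
  complex plane; its value at \<open>1\<close> is irrelevant.
\<close>

definition selberg_analytic :: "(nat \<Rightarrow> complex) \<Rightarrow> (complex \<Rightarrow> complex) \<Rightarrow> bool" where
  "selberg_analytic a F \<longleftrightarrow>
     (\<forall>s. Re s > 1 \<longrightarrow> F s = dseries a s) \<and>
     (\<exists>(m::nat) G. G holomorphic_on UNIV \<and> finite_order G \<and>
        (\<forall>s. s \<noteq> 1 \<longrightarrow> G s = (s - 1) ^ m * F s))"

definition gamma_factor ::
  "complex \<Rightarrow> real \<Rightarrow> nat \<Rightarrow> (nat \<Rightarrow> real) \<Rightarrow> (nat \<Rightarrow> complex) \<Rightarrow> complex \<Rightarrow> complex" where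
  "gamma_factor \<epsilon> Q k w \<mu> s =
     \<epsilon> * of_real Q powr s * (\<Prod>i=1..k. Gamma (of_real (w i) * s + \<mu> i))"

text \<open>
  The functional equation is an identity of meromorphic functions. It is therefore stated
  outside a set without limit points: at the poles of either side the values of the
  HOL functions are arbitrary (\<open>Gamma\<close> is \<open>0\<close> at its poles).
\<close>

definition selberg_functional_equation :: "(complex \<Rightarrow> complex) \<Rightarrow> bool" where
  "selberg_functional_equation F \<longleftrightarrow>
     (\<exists>\<epsilon> Q k w \<mu>. norm \<epsilon> = 1 \<and> Q > 0 \<and> (\<forall>i\<in>{1..k}. w i > 0 \<and> Re (\<mu> i) \<ge> 0) \<and>
        (let \<Phi> = (\<lambda>s. gamma_factor \<epsilon> Q k w \<mu> s * F s)
         in \<forall>\<^sub>\<approx>s\<in>UNIV. \<Phi> s = cnj (\<Phi> (cnj (1 - s)))))"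

definition ramanujan_hypothesis :: "(nat \<Rightarrow> complex) \<Rightarrow> bool" where
  "ramanujan_hypothesis a \<longleftrightarrow>
     (\<forall>\<epsilon>>0. (\<lambda>n. norm (a n)) \<in> O(\<lambda>n. real n powr \<epsilon>))"

text \<open>
  That \<open>\<Sum> b n / n^s\<close> is the logarithm of the series of \<open>a\<close> is expressed through the
  exponential, which involves no choice of branch: as \<open>b 1 = 0\<close>, the sum tends to \<open>0\<close> as
  \<open>Re s \<rightarrow> \<infinity>\<close>, so it is the branch of the logarithm that vanishes there.
\<close>

definition selberg_euler_product :: "(nat \<Rightarrow> complex) \<Rightarrow> bool" where
  "selberg_euler_product a \<longleftrightarrow> a 1 = 1 \<and>
     (\<exists>b. (\<forall>n. \<not> primepow n \<longrightarrow> b n = 0) \<and>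
          (\<exists>\<theta><1/2. (\<lambda>n. norm (b n)) \<in> O(\<lambda>n. real n powr \<theta>)) \<and>
          (\<forall>s. Re s > 1 \<longrightarrow>
             summable (\<lambda>n. b (Suc n) / of_nat (Suc n) powr s) \<and>
             exp (dseries b s) = dseries a s))"

definition selberg_class :: "(nat \<Rightarrow> complex) set" where
  "selberg_class = {a. a 0 = 0 \<and>
     (\<exists>F. selberg_analytic a F \<and> selberg_functional_equation F) \<and>
     ramanujan_hypothesis a \<and> selberg_euler_product a}"

text \<open>Products of elements are products of the functions on the half-plane \<open>Re s > 1\<close>.\<close>

definition selberg_primitive :: "(nat \<Rightarrow> complex) \<Rightarrow> bool" where
  "selberg_primitive a \<longleftrightarrow> a \<in> selberg_class \<and> a \<noteq> one_series \<and>
     (\<forall>a\<^sub>1\<in>selberg_class. \<forall>a\<^sub>2\<in>selberg_class.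
        (\<forall>s. Re s > 1 \<longrightarrow> dseries a s = dseries a\<^sub>1 s * dseries a\<^sub>2 s) \<longrightarrow>
        a\<^sub>1 = one_series \<or> a\<^sub>2 = one_series)"

definition dirichlet_char :: "nat \<Rightarrow> (nat \<Rightarrow> complex) \<Rightarrow> bool" where
  "dirichlet_char q \<psi> \<longleftrightarrow> q > 0 \<and> (\<forall>m n. \<psi> (m * n) = \<psi> m * \<psi> n) \<and>
     (\<forall>n. \<psi> (n + q) = \<psi> n) \<and> (\<forall>n. \<psi> n \<noteq> 0 \<longleftrightarrow> coprime n q)"

definition primitive_dirichlet_char :: "nat \<Rightarrow> (nat \<Rightarrow> complex) \<Rightarrow> bool" where
  "primitive_dirichlet_char q \<psi> \<longleftrightarrow> dirichlet_char q \<psi> \<and>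
     \<not> (\<exists>d \<eta>. d dvd q \<and> d < q \<and> dirichlet_char d \<eta> \<and> (\<forall>n. coprime n q \<longrightarrow> \<psi> n = \<eta> n))"

definition twist :: "(nat \<Rightarrow> complex) \<Rightarrow> (nat \<Rightarrow> complex) \<Rightarrow> nat \<Rightarrow> complex" where
  "twist a \<psi> n = a n * \<psi> n"

text \<open>
  \<open>selberg_n a\<close> is the integer \<open>n\<^sub>F\<close>. There is at most one, as \<open>ln (ln x)\<close> is unbounded;
  that there is one is the first conjecture.
\<close>

definition regularity :: "(nat \<Rightarrow> complex) \<Rightarrow> int \<Rightarrow> bool" where
  "regularity a n \<longleftrightarrow>
     (\<lambda>x::real. (\<Sum>p | prime p \<and> real p \<le> x. (norm (a p))\<^sup>2 / real p) - of_int n * ln (ln x))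
       \<in> O[at_top](\<lambda>_. 1)"

definition selberg_n :: "(nat \<Rightarrow> complex) \<Rightarrow> int" where
  "selberg_n a = (THE n. regularity a n)"

definition selberg_conjecture_A :: bool where
  "selberg_conjecture_A \<longleftrightarrow> (\<forall>a\<in>selberg_class. \<exists>n. regularity a n)"

text \<open>
  The condition \<open>n\<^sub>F = 1\<close> concerns each primitive element by itself; only the second
  condition concerns pairs of distinct ones.
\<close>

definition selberg_conjecture_B :: bool where
  "selberg_conjecture_B \<longleftrightarrow>
     (\<forall>a. selberg_primitive a \<longrightarrow> selberg_n a = 1) \<and>
     (\<forall>a a'. selberg_primitive a \<and> selberg_primitive a' \<and> a \<noteq> a' \<longrightarrow>
        (\<lambda>x::real. \<Sum>p | prime p \<and> real p \<le> x. a p * cnj (a' p) / of_nat p)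
          \<in> O[at_top](\<lambda>_. 1))"

definition selberg_conjecture_C :: bool where
  "selberg_conjecture_C \<longleftrightarrow>
     (\<forall>q \<psi> a k f. primitive_dirichlet_char q \<psi> \<and>
        a \<in> selberg_class \<and> twist a \<psi> \<in> selberg_class \<and>
        (\<forall>i\<in>{1..k::nat}. selberg_primitive (f i)) \<and>
        (\<forall>s. Re s > 1 \<longrightarrow> dseries a s = (\<Prod>i=1..k. dseries (f i) s)) \<longrightarrow>
        (\<forall>s. Re s > 1 \<longrightarrow> dseries (twist a \<psi>) s = (\<Prod>i=1..k. dseries (twist (f i) \<psi>) s)) \<and>
        (\<forall>i\<in>{1..k}. selberg_primitive (twist (f i) \<psi>)))"

end

theory Submission
  imports Defs "HOL-Real_Asymp.Real_Asymp"
begin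

text \<open>
  Comparing coefficients at primes in \<open>F = \<Prod> F\<^sub>i ^ e\<^sub>i\<close>, where all leading coefficients are \<open>1\<close>,
  gives \<open>F p = \<Sum> e\<^sub>i F\<^sub>i p\<close>. Expand \<open>\<bar>F p\<bar>\<^sup>2 / p\<close> and sum over \<open>p \<le> x\<close>: by orthonormality the
  diagonal terms contribute \<open>(\<Sum> e\<^sub>i\<^sup>2) log log x + O(1)\<close> and the others \<open>O(1)\<close>, and
  \<open>log log x\<close> is unbounded.
\<close>

section \<open>Absolute convergence of Dirichlet series\<close>

definition dseries_abs_conv :: "(nat \<Rightarrow> complex) \<Rightarrow> complex \<Rightarrow> bool" where
  "dseries_abs_conv a s \<longleftrightarrow> (\<lambda>n. norm (a n / of_nat n powr s)) summable_on {0<..}"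

lemma bij_betw_Suc_greaterThan: "bij_betw Suc UNIV {0<..}"
  by (rule bij_betwI[where g = "\<lambda>n. n - 1"]) auto

text \<open>Links the unordered sum over positive indices, suited to regrouping, with the shifted
  sequence in \<open>dseries\<close>, suited to comparison tests.\<close>

lemma dseries_abs_conv_iff:
  "dseries_abs_conv a s \<longleftrightarrow> summable (\<lambda>n. norm (a (Suc n) / of_nat (Suc n) powr s))"
  unfolding dseries_abs_conv_def
  using summable_on_reindex_bij_betw[OF bij_betw_Suc_greaterThan,
      of "\<lambda>n. norm (a n / of_nat n powr s)"]
  by (subst (asm) summable_on_UNIV_nonneg_real_iff) auto

lemma dseries_has_sum:
  assumes "dseries_abs_conv a s"
  shows   "((\<lambda>n. a n / of_nat n powr s) has_sum dseries a s) {0<..}"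
proof -
  have sm: "summable (\<lambda>n. norm (a (Suc n) / of_nat (Suc n) powr s))"
    using assms by (simp only: dseries_abs_conv_iff)
  have "((\<lambda>n. a (Suc n) / of_nat (Suc n) powr s) has_sum dseries a s) UNIV"
    unfolding dseries_def
    by (intro norm_summable_imp_has_sum sm summable_sums summable_norm_cancel[OF sm])
  thus ?thesis
    by (subst (asm) has_sum_reindex_bij_betw[OF bij_betw_Suc_greaterThan,
      of "\<lambda>n. a n / of_nat n powr s"])
qed

section \<open>Dirichlet convolution and products of series\<close>

definition dirichlet_conv :: "(nat \<Rightarrow> complex) \<Rightarrow> (nat \<Rightarrow> complex) \<Rightarrow> nat \<Rightarrow> complex" where
  "dirichlet_conv a b n = (\<Sum>d | d dvd n. a d * b (n div d))"

lemma dirichlet_conv_1: "dirichlet_conv a b 1 = a 1 * b 1"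
  by (simp add: dirichlet_conv_def)

lemma dirichlet_conv_prime:
  assumes "prime p"
  shows   "dirichlet_conv a b p = a 1 * b p + a p * b 1"
proof -
  have "{d. d dvd p} = {1, p}" "p \<noteq> 1" "p > 0"
    using assms by (auto simp: prime_nat_iff)
  thus ?thesis by (simp add: dirichlet_conv_def)
qed

text \<open>Absolute convergence permits regrouping the double series over pairs of positive
  integers by their product; each group is finite, being indexed by divisors.\<close>

lemma dirichlet_conv_dseries:
  assumes a: "dseries_abs_conv a s" and b: "dseries_abs_conv b s"
  shows   "dseries_abs_conv (dirichlet_conv a b) s"
    and   "dseries (dirichlet_conv a b) s = dseries a s * dseries b s"
proof -
  let ?A = "\<lambda>n. a n / of_nat n powr s" and ?B = "\<lambda>n. b n / of_nat n powr s"
  let ?P = "{0<..} :: nat set"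
  let ?D = "Sigma ?P (\<lambda>n. {d. d dvd n})"
  define h where "h = (\<lambda>(m,n). ?A m * ?B n)"
  define g where "g = (\<lambda>(n,d). ?A d * ?B (n div d))"
  have A: "(\<lambda>n. norm (?A n)) summable_on ?P" and B: "(\<lambda>n. norm (?B n)) summable_on ?P"
    using a b by (simp_all add: dseries_abs_conv_def)
  have h: "(\<lambda>x. norm (h x)) summable_on ?P \<times> ?P"
    unfolding Infinite_Sum.abs_summable_on_Sigma_iff h_def prod.case norm_mult
    using A B by (auto simp: infsum_cmult_right' infsum_nonneg
      intro!: summable_on_cmult_right summable_on_cmult_left)
  have hs: "(h has_sum (dseries a s * dseries b s)) (?P \<times> ?P)"
  proof (rule has_sum_SigmaI)
    show "((\<lambda>n. h (m, n)) has_sum (?A m * dseries b s)) ?P" for m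
      unfolding h_def prod.case by (intro has_sum_cmult_right dseries_has_sum b)
    show "((\<lambda>m. ?A m * dseries b s) has_sum (dseries a s * dseries b s)) ?P"
      by (intro has_sum_cmult_left dseries_has_sum a)
    show "h summable_on ?P \<times> ?P" using h by (rule abs_summable_summable)
  qed
  \<comment> \<open>A pair of factors corresponds to its product together with the first
    factor.\<close>
  have bij: "bij_betw (\<lambda>(n,d). (d, n div d)) ?D (?P \<times> ?P)"
    by (rule bij_betwI[where g = "\<lambda>(m,n). (m * n, m)"]) (auto elim!: dvdE)
  have gh: "g = (\<lambda>x. h ((\<lambda>(n,d). (d, n div d)) x))"
    by (auto simp: g_def h_def)
  have gs: "(g has_sum (dseries a s * dseries b s)) ?D"
    unfolding gh using hs by (subst has_sum_reindex_bij_betw[OF bij])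
  have ga: "(\<lambda>x. norm (g x)) summable_on ?D"
    unfolding gh using h
    by (subst summable_on_reindex_bij_betw[OF bij, of "\<lambda>x. norm (h x)"])
  have eq: "(\<Sum>d | d dvd n. g (n, d)) = dirichlet_conv a b n / of_nat n powr s"
    if "n \<in> ?P" for n
    unfolding dirichlet_conv_def sum_divide_distrib
  proof (rule sum.cong)
    fix d assume "d \<in> {d. d dvd n}"
    then obtain k where k: "n = d * k" by auto
    with that have "d > 0" by auto
    have "(of_nat (d * k) :: complex) powr s = of_nat d powr s * of_nat k powr s"
      unfolding of_nat_mult by (rule powr_times_real) auto
    thus "g (n, d) = a d * b (n div d) / of_nat n powr s"
      using k \<open>d > 0\<close> by (simp add: g_def)
  qed auto
  have fin: "finite {d. d dvd n}" if "n \<in> ?P" for n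
    using that by simp
  \<comment> \<open>The sum of \<open>norm (g (n,d))\<close> over the divisors of \<open>n\<close>
    is summable in \<open>n\<close> and dominates the convolution term.\<close>
  have "(\<lambda>n. norm (infsum (\<lambda>d. norm (g (n,d))) {d. d dvd n})) summable_on ?P"
    using ga unfolding Infinite_Sum.abs_summable_on_Sigma_iff by blast
  hence "(\<lambda>n. norm (dirichlet_conv a b n / of_nat n powr s)) summable_on ?P"
  proof (rule Infinite_Sum.abs_summable_on_comparison_test)
    fix n assume n: "n \<in> ?P"
    have "norm (\<Sum>d | d dvd n. g (n, d)) \<le> (\<Sum>d | d dvd n. norm (g (n,d)))"
      by (rule norm_sum)
    thus "norm (dirichlet_conv a b n / of_nat n powr s)
        \<le> norm (infsum (\<lambda>d. norm (g (n,d))) {d. d dvd n})"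
      using n fin[OF n] by (simp add: eq[OF n] sum_nonneg)
  qed
  thus ac: "dseries_abs_conv (dirichlet_conv a b) s"
    by (simp add: dseries_abs_conv_def)
  \<comment> \<open>Summing \<open>g\<close> fibre by fibre gives the same total as summing it over
    all pairs.\<close>
  have "((\<lambda>n. dirichlet_conv a b n / of_nat n powr s) has_sum (dseries a s * dseries b s)) ?P"
  proof (rule has_sum_SigmaD[OF gs])
    fix n assume n: "n \<in> ?P"
    show "((\<lambda>d. g (n, d)) has_sum dirichlet_conv a b n / of_nat n powr s) {d. d dvd n}"
      using has_sum_finite[OF fin[OF n], of "\<lambda>d. g (n, d)"] eq[OF n] by simp
  qed
  with dseries_has_sum[OF ac] show "dseries (dirichlet_conv a b) s = dseries a s * dseries b s"
    by (rule has_sum_unique)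
qed

section \<open>Coefficients of finite products of powers\<close>

lemma dseries_one_series:
  "dseries_abs_conv one_series s" "dseries one_series s = 1"
proof -
  have *: "one_series (Suc n) / of_nat (Suc n) powr s = (if n = 0 then 1 else 0)" for n
    by (auto simp: one_series_def)
  show "dseries one_series s = 1"
    unfolding dseries_def * by (subst suminf_finite[of "{0}"]) auto
  show "dseries_abs_conv one_series s"
    unfolding dseries_abs_conv_iff * by (rule summable_finite[of "{0}"]) auto
qed

text \<open>Each induction step convolves with \<open>a\<close> once more. Both leading coefficients
  being 1, coefficients at a prime add up under convolution, hence the factor \<open>m\<close>. The
  set \<open>S\<close> makes a single \<open>c\<close> serve for all \<open>s\<close>.\<close>

lemma dseries_power_coeffs:
  assumes "\<And>s. s \<in> S \<Longrightarrow> dseries_abs_conv a s" "a 1 = 1"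
  obtains c where "\<And>s. s \<in> S \<Longrightarrow> dseries_abs_conv c s"
    "\<And>s. s \<in> S \<Longrightarrow> dseries c s = dseries a s ^ m"
    "c 1 = 1" "\<And>p. prime p \<Longrightarrow> c p = of_nat m * a p"
proof (induction m arbitrary: thesis)
  case 0
  show ?case
    by (rule 0[of one_series])
       (auto simp: dseries_one_series, auto simp: one_series_def)
next
  case (Suc m)
  obtain c where c: "\<And>s. s \<in> S \<Longrightarrow> dseries_abs_conv c s"
    "\<And>s. s \<in> S \<Longrightarrow> dseries c s = dseries a s ^ m"
    "c 1 = 1" "\<And>p. prime p \<Longrightarrow> c p = of_nat m * a p"
    using Suc.IH by blast
  show ?case
    by (rule Suc.prems[of "dirichlet_conv a c"])
       (use assms c in \<open>simp_all add: dirichlet_conv_dseries dirichlet_conv_1[simplified]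
         dirichlet_conv_prime algebra_simps\<close>)
qed

text \<open>The same additivity at primes, now by induction on the index set, with one power
  convolved in at each step.\<close>

lemma dseries_prod_power_coeffs:
  assumes "finite I"
    and "\<And>i s. i \<in> I \<Longrightarrow> s \<in> S \<Longrightarrow> dseries_abs_conv (a i) s" "\<And>i. i \<in> I \<Longrightarrow> a i 1 = 1"
  obtains c where "\<And>s. s \<in> S \<Longrightarrow> dseries_abs_conv c s"
    "\<And>s. s \<in> S \<Longrightarrow> dseries c s = (\<Prod>i\<in>I. dseries (a i) s ^ e i)"
    "c 1 = 1" "\<And>p. prime p \<Longrightarrow> c p = (\<Sum>i\<in>I. of_nat (e i) * a i p)"
  using assms
proof (induction I arbitrary: thesis rule: finite_induct)
  case empty
  show ?case
    by (rule empty.prems(1)[of one_series])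
       (auto simp: dseries_one_series, auto simp: one_series_def)
next
  case (insert i I)
  obtain c where c: "\<And>s. s \<in> S \<Longrightarrow> dseries_abs_conv c s"
    "\<And>s. s \<in> S \<Longrightarrow> dseries c s = (\<Prod>i\<in>I. dseries (a i) s ^ e i)"
    "c 1 = 1" "\<And>p. prime p \<Longrightarrow> c p = (\<Sum>i\<in>I. of_nat (e i) * a i p)"
    using insert.IH insert.prems(2,3) by blast
  obtain d where d: "\<And>s. s \<in> S \<Longrightarrow> dseries_abs_conv d s"
    "\<And>s. s \<in> S \<Longrightarrow> dseries d s = dseries (a i) s ^ e i"
    "d 1 = 1" "\<And>p. prime p \<Longrightarrow> d p = of_nat (e i) * a i p"
    using dseries_power_coeffs[of S "a i" "e i"] insert.prems(2,3) by blast
  show ?case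
    by (rule insert.prems(1)[of "dirichlet_conv d c"])
       (use c d insert.hyps in \<open>simp_all add: dirichlet_conv_dseries
         dirichlet_conv_1[simplified] dirichlet_conv_prime algebra_simps\<close>)
qed

section \<open>Convergence on the half-plane and uniqueness of coefficients\<close>

lemma ramanujan_imp_dseries_abs_conv:
  assumes "ramanujan_hypothesis a" "Re s > 1"
  shows   "dseries_abs_conv a s"
proof -
  \<comment> \<open>Half of the excess of \<open>Re s\<close> over 1 makes the exponent
    \<open>\<epsilon> - Re s\<close> below equal to \<open>- 1 - \<epsilon>\<close>, so the
    comparison series converges.\<close>
  define \<epsilon> where "\<epsilon> = (Re s - 1) / 2"
  have "\<epsilon> > 0" using assms by (simp add: \<epsilon>_def)
  hence "(\<lambda>n. norm (a n)) \<in> O(\<lambda>n. real n powr \<epsilon>)"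
    using assms by (auto simp: ramanujan_hypothesis_def)
  then obtain C where C: "eventually (\<lambda>n. norm (a n) \<le> C * real n powr \<epsilon>) sequentially"
    by (auto elim!: landau_o.bigE)
  have "summable (\<lambda>n. norm (a n / of_nat n powr s))"
  proof (rule summable_comparison_test_ev)
    show "eventually (\<lambda>n. norm (norm (a n / of_nat n powr s)) \<le> C * real n powr (\<epsilon> - Re s)) sequentially"
      using C eventually_gt_at_top[of 0]
    proof eventually_elim
      case (elim n)
      have "norm (a n / of_nat n powr s) = norm (a n) / real n powr Re s"
        using elim by (simp add: norm_divide norm_powr_real_powr)
      also have "\<dots> \<le> C * real n powr \<epsilon> / real n powr Re s"
        using elim by (intro divide_right_mono) auto
      finally show ?case using elim by (simp add: powr_diff)
    qed
    show "summable (\<lambda>n. C * real n powr (\<epsilon> - Re s))"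
      using \<open>\<epsilon> > 0\<close> by (intro summable_mult) (simp add: summable_real_powr_iff \<epsilon>_def field_simps)
  qed
  thus ?thesis
    unfolding dseries_abs_conv_iff
    by (subst summable_Suc_iff[of "\<lambda>n. norm (a n / of_nat n powr s)"])
qed

lemma dseries_diff:
  assumes "dseries_abs_conv a s" "dseries_abs_conv b s"
  shows   "dseries_abs_conv (\<lambda>n. a n - b n) s"
    and   "dseries (\<lambda>n. a n - b n) s = dseries a s - dseries b s"
proof -
  show "dseries_abs_conv (\<lambda>n. a n - b n) s"
    unfolding dseries_abs_conv_iff diff_divide_distrib
    using summable_add[OF assms[unfolded dseries_abs_conv_iff]]
    by (rule summable_comparison_test'[where N = 0]) (simp add: norm_triangle_ineq4 del: of_nat_Suc)
  show "dseries (\<lambda>n. a n - b n) s = dseries a s - dseries b s"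
    unfolding dseries_def diff_divide_distrib
    using assms[unfolded dseries_abs_conv_iff, THEN summable_norm_cancel]
    by (rule suminf_diff[symmetric])
qed

text \<open>
  If \<open>m\<close> is the least index with \<open>a m \<noteq> 0\<close>, then multiplying the series by \<open>m^s\<close> and
  letting \<open>s \<rightarrow> \<infinity>\<close> isolates the term \<open>a m\<close>.
\<close>
lemma dseries_zero_imp_coeff_zero:
  assumes ac: "dseries_abs_conv a (of_nat N)"
    and zero: "\<And>k. k \<ge> N \<Longrightarrow> dseries a (of_nat k) = 0"
    and "n > 0"
  shows "a n = 0"
  using \<open>n > 0\<close>
proof (induction n rule: less_induct)
  case (less m)
  \<comment> \<open>This is the term with index \<open>Suc n\<close> of the series at
    \<open>k\<close>, multiplied by \<open>m ^ k\<close>.\<close>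
  define f where "f = (\<lambda>n k. a (Suc n) * (of_nat m / of_nat (Suc n)) ^ k)"
  \<comment> \<open>The majorant for Tannery's theorem: the exponent is frozen at \<open>N\<close>,
    where absolute convergence is given.\<close>
  define M where "M = (\<lambda>n. real m ^ N * norm (a (Suc n) / of_nat (Suc n) powr of_nat N))"
  have pow: "(of_nat (Suc n) :: complex) powr of_nat k = of_nat (Suc n) ^ k" for n k
    by (subst powr_nat') (auto simp del: of_nat_Suc)
  \<comment> \<open>The induction hypothesis removes exactly the terms whose ratio exceeds 1 and
    whose powers would grow.\<close>
  have low: "f n k = 0" if "Suc n < m" for n k
    using less.IH[OF that] by (simp add: f_def)
  have M_eq: "M n = norm (a (Suc n)) * (real m / real (Suc n)) ^ N" for n
    unfolding M_def pow by (simp add: norm_divide norm_power power_divide del: of_nat_Suc)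
  have bound: "norm (f n k) \<le> M n" if "k \<ge> N" for n k
  proof (cases "Suc n < m")
    case True
    thus ?thesis by (simp add: low M_def)
  next
    case False
    hence "real m / real (Suc n) \<le> 1" by simp
    hence "(real m / real (Suc n)) ^ k \<le> (real m / real (Suc n)) ^ N"
      using that by (intro power_decreasing) auto
    thus ?thesis
      unfolding M_eq f_def
      by (simp add: norm_mult norm_power norm_divide mult_left_mono del: of_nat_Suc)
  qed
  \<comment> \<open>Because of the shift by \<open>Suc\<close>, ratio 1 occurs at
    \<open>n = m - 1\<close>; later indices have ratio below 1.\<close>
  have lim: "(f n \<longlongrightarrow> (if n = m - 1 then a m else 0)) sequentially" for n
  proof (cases "Suc n < m")
    case True
    hence "f n = (\<lambda>_. 0)" using low by blast
    thus ?thesis using True by auto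
  next
    case False
    show ?thesis
    proof (cases "Suc n = m")
      case True
      hence "f n = (\<lambda>k. a m)" using less.prems by (auto simp: f_def simp del: of_nat_Suc)
      thus ?thesis using True by auto
    next
      case neq: False
      hence "norm (of_nat m / of_nat (Suc n) :: complex) < 1"
        using False by (simp add: norm_divide del: of_nat_Suc)
      hence "f n \<longlonglongrightarrow> a (Suc n) * 0"
        unfolding f_def by (intro tendsto_mult tendsto_const LIMSEQ_power_zero)
      moreover have "n \<noteq> m - 1" using neq less.prems by linarith
      ultimately show ?thesis by simp
    qed
  qed
  have "summable M"
    unfolding M_def using ac unfolding dseries_abs_conv_iff by (intro summable_mult)
  moreover have "eventually (\<lambda>(n,k). norm (f n k) \<le> M n) (at_top \<times>\<^sub>F sequentially)"
    using eventually_prodI[of "\<lambda>_. True" at_top "\<lambda>k. k \<ge> N" sequentially, OF _ eventually_ge_at_top]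
    by (rule eventually_mono) (auto intro: bound)
  ultimately have "(\<lambda>k. \<Sum>n. f n k) \<longlonglongrightarrow> (\<Sum>n. if n = m - 1 then a m else 0)"
    using tannerys_theorem[of f _ sequentially M] lim by auto
  moreover have "(\<Sum>n. if n = m - 1 then a m else 0) = a m"
    by (subst suminf_finite[of "{m - 1}"]) auto
  \<comment> \<open>Dividing by \<open>m ^ k\<close> gives back the series at \<open>k\<close>,
    which vanishes for \<open>k \<ge> N\<close>; so the limit \<open>a m\<close> must be 0.\<close>
  moreover have "eventually (\<lambda>k. (\<Sum>n. f n k) = 0) sequentially"
    using eventually_ge_at_top[of N]
  proof eventually_elim
    case (elim k)
    have "summable (\<lambda>n. norm (f n k))"
      by (rule summable_comparison_test'[OF \<open>summable M\<close>]) (use bound elim in auto)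
    hence "summable (\<lambda>n. f n k)"
      by (rule summable_norm_cancel)
    hence "(\<Sum>n. f n k / of_nat m ^ k) = (\<Sum>n. f n k) / of_nat m ^ k"
      by (rule suminf_divide)
    moreover have "(\<lambda>n. f n k / of_nat m ^ k) = (\<lambda>n. a (Suc n) / of_nat (Suc n) powr of_nat k)"
      unfolding pow using less.prems by (auto simp: f_def power_divide del: of_nat_Suc)
    ultimately have "dseries a (of_nat k) = (\<Sum>n. f n k) / of_nat m ^ k"
      by (simp only: dseries_def)
    thus ?case using zero[OF elim] less.prems by simp
  qed
  ultimately show "a m = 0"
    by (metis tendsto_eventually LIMSEQ_unique)
qed

text \<open>The difference of the series vanishes on the half-plane, in particular at all integers
  from 2 on.\<close>

lemma dseries_eq_imp_coeff_eq:
  assumes "\<And>s. Re s > 1 \<Longrightarrow> dseries_abs_conv a s" "\<And>s. Re s > 1 \<Longrightarrow> dseries_abs_conv b s"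
    and "\<And>s. Re s > 1 \<Longrightarrow> dseries a s = dseries b s" "n > 0"
  shows "a n = b n"
proof -
  have "a n - b n = 0"
  proof (rule dseries_zero_imp_coeff_zero[of "\<lambda>n. a n - b n" 2])
    show "dseries_abs_conv (\<lambda>n. a n - b n) (of_nat 2)"
      by (intro dseries_diff assms) auto
    show "dseries (\<lambda>n. a n - b n) (of_nat k) = 0" if "k \<ge> 2" for k
      using that by (subst dseries_diff) (auto intro!: assms)
  qed fact
  thus ?thesis by simp
qed

section \<open>The integer \<open>selberg_n\<close> and sums over primes\<close>

lemma regularity_unique:
  assumes "regularity a m" "regularity a n"
  shows   "m = n"
proof (rule ccontr)
  assume "m \<noteq> n"
  \<comment> \<open>The two sums over primes cancel, leaving only a multiple of
    \<open>ln (ln x)\<close>.\<close>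
  have "(\<lambda>x. of_int (m - n) * ln (ln x)) \<in> O[at_top](\<lambda>_. 1 :: real)"
    using sum_in_bigo(2)[OF assms(2,1)[unfolded regularity_def]] by (simp add: algebra_simps)
  hence "(\<lambda>x::real. ln (ln x)) \<in> O[at_top](\<lambda>_. 1 :: real)"
    using \<open>m \<noteq> n\<close> by (subst (asm) landau_o.big.cmult_in_iff) auto
  moreover have "(\<lambda>_. 1 :: real) \<in> o[at_top](\<lambda>x::real. ln (ln x))"
    by real_asymp
  ultimately have "(\<lambda>_. 1 :: real) \<in> o[at_top](\<lambda>_::real. 1 :: real)"
    by (blast intro: landau_o.small_big_trans)
  \<comment> \<open>The constant 1/2 in the little-o condition would give 1 \<le> 1/2.\<close>
  thus False
    by (auto simp: smallo_def dest!: spec[of _ "1 / 2"])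
qed

lemma selberg_n_eqI: "regularity a n \<Longrightarrow> selberg_n a = n"
  unfolding selberg_n_def by (blast intro: the_equality regularity_unique)

text \<open>Conjecture (A) supplies existence, so the definite description denotes a value with the
  required property.\<close>

lemma regularity_selberg_n:
  assumes "selberg_conjecture_A" "a \<in> selberg_class"
  shows   "regularity a (selberg_n a)"
  using assms selberg_n_eqI unfolding selberg_conjecture_A_def by metis

text \<open>Rests on \<open>z * cnj z\<close> being the squared norm. In this form the diagonal sums
  have the shape of those in conjecture (B), so both fit into one double sum.\<close>

lemma regularity_iff_complex:
  "regularity a n \<longleftrightarrow>
     (\<lambda>x::real. (\<Sum>p | prime p \<and> real p \<le> x. a p * cnj (a p) / of_nat p)
        - of_int n * of_real (ln (ln x))) \<in> O[at_top](\<lambda>_. 1 :: complex)"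
proof -
  have "(\<Sum>p | prime p \<and> real p \<le> x. a p * cnj (a p) / of_nat p) - of_int n * of_real (ln (ln x))
      = (of_real ((\<Sum>p | prime p \<and> real p \<le> x. (norm (a p))\<^sup>2 / real p)
        - of_int n * ln (ln x)) :: complex)" for x :: real
    by (simp only: complex_norm_square[symmetric] of_real_sum of_real_diff of_real_mult
        of_real_divide of_real_of_nat_eq of_real_of_int_eq)
  thus ?thesis
    unfolding regularity_def bigo_def by (simp del: of_real_diff)
qed

lemma regularity_linear_combination:
  assumes "finite I"
    and ap: "\<And>p. prime p \<Longrightarrow> a p = (\<Sum>i\<in>I. of_nat (e i) * f i p)"
    and diag: "\<And>i. i \<in> I \<Longrightarrow> regularity (f i) 1"
    and off: "\<And>i j. i \<in> I \<Longrightarrow> j \<in> I \<Longrightarrow> i \<noteq> j \<Longrightarrow>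
      (\<lambda>x::real. \<Sum>p | prime p \<and> real p \<le> x. f i p * cnj (f j p) / of_nat p) \<in> O[at_top](\<lambda>_. 1)"
  shows "regularity a (\<Sum>i\<in>I. int (e i) ^ 2)"
proof -
  define T where "T = (\<lambda>i j (x::real). \<Sum>p | prime p \<and> real p \<le> x. f i p * cnj (f j p) / of_nat p)"
  define L where "L = (\<lambda>x::real. complex_of_real (ln (ln x)))"
  \<comment> \<open>Subtracting the main term on the diagonal makes every entry bounded, so a single
    estimate covers the whole double sum.\<close>
  define R where "R = (\<lambda>i j x. T i j x - (if i = j then L x else 0))"
  have R: "R i j \<in> O[at_top](\<lambda>_. 1)" if "i \<in> I" "j \<in> I" for i j
    using off[OF that] diag[OF that(1)]
    by (cases "i = j") (simp_all add: R_def T_def L_def regularity_iff_complex)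
  have "(\<lambda>x. \<Sum>i\<in>I. \<Sum>j\<in>I. of_nat (e i) * of_nat (e j) * R i j x) \<in> O[at_top](\<lambda>_. 1)"
    by (intro big_sum_in_bigo) (auto intro: R landau_o.big.mult_in_1)
  moreover have "(\<Sum>p | prime p \<and> real p \<le> x. a p * cnj (a p) / of_nat p)
      - of_int (\<Sum>i\<in>I. int (e i) ^ 2) * of_real (ln (ln x))
      = (\<Sum>i\<in>I. \<Sum>j\<in>I. of_nat (e i) * of_nat (e j) * R i j x)" for x
  proof -
    have "(\<Sum>p | prime p \<and> real p \<le> x. a p * cnj (a p) / of_nat p)
        = (\<Sum>p | prime p \<and> real p \<le> x. \<Sum>i\<in>I. \<Sum>j\<in>I.
            of_nat (e i) * of_nat (e j) * (f i p * cnj (f j p) / of_nat p))"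
      by (intro sum.cong) (auto simp: ap sum_product sum_divide_distrib mult_ac)
    \<comment> \<open>One interchange moves the prime sum past \<open>i\<close>, the second past
      \<open>j\<close>.\<close>
    also have "\<dots> = (\<Sum>i\<in>I. \<Sum>j\<in>I. of_nat (e i) * of_nat (e j) * T i j x)"
      unfolding T_def sum_distrib_left
      by (subst sum.swap, rule sum.cong[OF refl], subst sum.swap, rule refl)
    finally have 1: "(\<Sum>p | prime p \<and> real p \<le> x. a p * cnj (a p) / of_nat p) = \<dots>" .
    have 2: "(\<Sum>i\<in>I. \<Sum>j\<in>I. of_nat (e i) * of_nat (e j) * (if i = j then L x else 0))
        = (\<Sum>i\<in>I. of_nat (e i) ^ 2 * L x)"
      using \<open>finite I\<close>
      by (simp add: if_distrib[of "\<lambda>t. _ * t"] power2_eq_square cong: if_cong)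
    show ?thesis
      unfolding 1 R_def right_diff_distrib sum_subtractf 2
      by (simp add: L_def sum_distrib_right)
  qed
  ultimately show ?thesis
    unfolding regularity_iff_complex by simp
qed

theorem proposition4p1:
  fixes F :: "nat \<Rightarrow> complex" and Fs :: "nat \<Rightarrow> nat \<Rightarrow> complex" and e :: "nat \<Rightarrow> nat" and k :: nat
  assumes "selberg_conjecture_A" and "selberg_conjecture_B" and "selberg_conjecture_C"
    and "F \<in> selberg_class"
    and "\<And>i. i \<in> {1..k} \<Longrightarrow> selberg_primitive (Fs i)"
    and "inj_on Fs {1..k}"
    and "\<And>i. i \<in> {1..k} \<Longrightarrow> e i > 0"
    and "\<And>s. Re s > 1 \<Longrightarrow> dseries F s = (\<Prod>i=1..k. dseries (Fs i) s ^ e i)"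
  shows "selberg_n F = (\<Sum>i=1..k. int (e i) ^ 2)"
proof (rule selberg_n_eqI, rule regularity_linear_combination)
  have ac: "dseries_abs_conv a s" if "a \<in> selberg_class" "Re s > 1" for a s
    using that by (auto simp: selberg_class_def intro: ramanujan_imp_dseries_abs_conv)
  have Fs: "Fs i \<in> selberg_class" if "i \<in> {1..k}" for i
    using assms(5)[OF that] by (simp add: selberg_primitive_def)
  obtain c where c: "\<And>s. s \<in> {s. Re s > 1} \<Longrightarrow> dseries_abs_conv c s"
    "\<And>s. s \<in> {s. Re s > 1} \<Longrightarrow> dseries c s = (\<Prod>i=1..k. dseries (Fs i) s ^ e i)"
    "\<And>p. prime p \<Longrightarrow> c p = (\<Sum>i=1..k. of_nat (e i) * Fs i p)"
  proof (rule dseries_prod_power_coeffs[of "{1..k}" "{s. Re s > 1}" Fs e])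
    show "Fs i 1 = 1" if "i \<in> {1..k}" for i
      using Fs[OF that] by (simp add: selberg_class_def selberg_euler_product_def)
  qed (use ac Fs in auto)
  \<comment> \<open>\<open>F\<close> and \<open>c\<close> have equal series on the half-plane, so
    their coefficients at positive indices agree.\<close>
  show "F p = (\<Sum>i=1..k. of_nat (e i) * Fs i p)" if "prime p" for p
    using dseries_eq_imp_coeff_eq[of F c p] ac[OF assms(4)] c assms(8) that prime_gt_0_nat[of p]
    by auto
  \<comment> \<open>Conjecture (B) fixes only the value of \<open>selberg_n (Fs i)\<close>;
    conjecture (A) turns it into an asymptotic formula.\<close>
  show "regularity (Fs i) 1" if "i \<in> {1..k}" for i
    using regularity_selberg_n[OF assms(1) Fs[OF that]] assms(2) assms(5)[OF that]
    by (simp add: selberg_conjecture_B_def)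
  \<comment> \<open>Injectivity of \<open>Fs\<close> makes the two primitive elements distinct, as
    conjecture (B) requires.\<close>
  show "(\<lambda>x::real. \<Sum>p | prime p \<and> real p \<le> x. Fs i p * cnj (Fs j p) / of_nat p) \<in> O[at_top](\<lambda>_. 1)"
    if "i \<in> {1..k}" "j \<in> {1..k}" "i \<noteq> j" for i j
    using assms(2) assms(5)[OF that(1)] assms(5)[OF that(2)] inj_onD[OF assms(6)] that
    unfolding selberg_conjecture_B_def by blast
qed auto

end
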